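(* Let $h>0$, let $(\varepsilon_s)_{s\in\mathbb{Z}^2}$ be real numbers with $0<\varepsilon_{\min}\le\varepsilon_s\le\varepsilon_{\max}$ for all $s$ and some constants $\varepsilon_{\min},\varepsilon_{\max}$, and let $\boldsymbol{u}^{(2)}=(u_s)_{s\in\mathbb{Z}^2}$ be a real family with $\varepsilon_s u_s\neq 0$ for every $s\in\mathbb{Z}^2$ and $$(\boldsymbol{u}^{(2)})^{\mathsf T}\mathcal{B}^{(2)}\boldsymbol{u}^{(2)}=\sum_{s\in\mathbb{Z}^2}\varepsilon_s u_s^2<\infty .$$ Then the following statements hold. (i) The Rayleigh quotient is the weighted expectation of the pointwise Rayleigh quotients: $$\rho(\boldsymbol{u}^{(2)})=\frac{(\boldsymbol{u}^{(2)})^{\mathsf T}\mathcal{A}^{(2)}\boldsymbol{u}^{(2)}}{(\boldsymbol{u}^{(2)})^{\mathsf T}\mathcal{B}^{(2)}\boldsymbol{u}^{(2)}}=\mathbb{E}_{\mathrm p}\big[\{r_s\}_{s\in\mathbb{Z}^2}\big],\qquad p_s=\frac{\varepsilon_s u_s^2}{(\boldsymbol{u}^{(2)})^{\mathsf T}\mathcal{B}^{(2)}\boldsymbol{u}^{(2)}} .$$ (ii) Let $\lambda\in\mathbb{R}$, define the residual components $e_s=(\mathcal{A}^{(2)}\boldsymbol{u}^{(2)})_s-\lambda(\mathcal{B}^{(2)}\boldsymbol{u}^{(2)})_s$, and let $e_{\max}=\sup_{s\in\mathbb{Z}^2}|e_s|$. Assume additionally that $\sum_{s\in\mathbb{Z}^2}|u_s|<C_0$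 for some constant $C_0$. Then $$\mathbb{E}_{\mathrm p}\left[\left\{\left|\frac{e_s}{\varepsilon_s u_s}\right|\right\}_{s\in\mathbb{Z}^2}\right]\le C\,e_{\max},\qquad C=\frac{C_0}{(\boldsymbol{u}^{(2)})^{\mathsf T}\mathcal{B}^{(2)}\boldsymbol{u}^{(2)}} .$$ (iii) Under the assumptions of part (ii) (that is, $\lambda\in\mathbb{R}$, $e_s$, $e_{\max}$ and $C$ as defined there and $\sum_{s}|u_s|<C_0$), the bias estimate $$\Big|\mathbb{E}_{\mathrm p}\big[\{r_s\}_{s\in\mathbb{Z}^2}\big]-\lambda\Big|\le\mathbb{E}_{\mathrm p}\left[\left\{\left|\frac{e_s}{\varepsilon_s u_s}\right|\right\}_{s\in\mathbb{Z}^2}\right]\le C\,e_{\max}$$ holds.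
   Context: For $h>0$, the operators $\mathcal{A}^{(2)}=\mathcal{I}\otimes\mathcal{A}+\mathcal{A}\otimes\mathcal{I}$ (where $\mathcal{A}$ is the one-dimensional discrete operator $(\mathcal{A}\boldsymbol{v})_i=h^{-2}(-v_{i-1}+2v_i-v_{i+1})$) and $\mathcal{B}^{(2)}$ act on real families indexed by $s=(i,j)\in\mathbb{Z}^2$ by $$(\mathcal{A}^{(2)}\boldsymbol{u}^{(2)})_{i,j}=\frac{1}{h^2}\big(4u_{i,j}-u_{i+1,j}-u_{i-1,j}-u_{i,j+1}-u_{i,j-1}\big),\qquad (\mathcal{B}^{(2)}\boldsymbol{u}^{(2)})_{i,j}=\varepsilon_{i,j}u_{i,j}.$$ The pointwise Rayleigh quotients are $r_s=(\mathcal{A}^{(2)}\boldsymbol{u}^{(2)})_s/(\mathcal{B}^{(2)}\boldsymbol{u}^{(2)})_s$. For real families, $\boldsymbol{u}^{\mathsf T}\boldsymbol{v}=\sum_{s\in\mathbb{Z}^2}u_sv_s$. For probability weights $\mathrm p=(p_s)_{s\in\mathbb{Z}^2}$ and a real family $(x_s)$, $\mathbb{E}_{\mathrm p}[\{x_s\}]=\sum_{s\in\mathbb{Z}^2}p_sx_s$. *)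

theory Defs
  imports "HOL-Analysis.Analysis"
begin

type_synonym grid_fun = "int \<times> int \<Rightarrow> real"

definition A1 :: "real \<Rightarrow> (int \<Rightarrow> real) \<Rightarrow> int \<Rightarrow> real" where
  "A1 h v i = (1 / h\<^sup>2) * (- v (i - 1) + 2 * v i - v (i + 1))"

definition A2 :: "real \<Rightarrow> grid_fun \<Rightarrow> grid_fun" where
  "A2 h u = (\<lambda>(i, j). (1 / h\<^sup>2) *
     (4 * u (i, j) - u (i + 1, j) - u (i - 1, j) - u (i, j + 1) - u (i, j - 1)))"

text \<open>The five-point operator is the Kronecker sum: the one-dimensional operator applied in
  each of the two coordinate directions.\<close>
lemma A2_eq_kronecker_sum:
  "A2 h u (i, j) = A1 h (\<lambda>l. u (i, l)) j + A1 h (\<lambda>k. u (k, j)) i"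
  by (simp add: A2_def A1_def algebra_simps)

definition B2 :: "grid_fun \<Rightarrow> grid_fun \<Rightarrow> grid_fun" where
  "B2 eps u s = eps s * u s"

text \<open>Infinite sums are unordered sums over the whole lattice. As \<open>infsum\<close> is 0 for families
  that are not summable, summability has to be stated separately wherever a sum is meant
  to converge.\<close>
definition pairing :: "grid_fun \<Rightarrow> grid_fun \<Rightarrow> real" where
  "pairing u v = (\<Sum>\<^sub>\<infinity>s\<in>UNIV. u s * v s)"

definition rayleigh :: "real \<Rightarrow> grid_fun \<Rightarrow> grid_fun \<Rightarrow> real" where
  "rayleigh h eps u = pairing u (A2 h u) / pairing u (B2 eps u)"

definition pointwise_rayleigh :: "real \<Rightarrow> grid_fun \<Rightarrow> grid_fun \<Rightarrow> grid_fun" where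
  "pointwise_rayleigh h eps u s = A2 h u s / B2 eps u s"

definition prob_weights :: "grid_fun \<Rightarrow> bool" where
  "prob_weights p \<longleftrightarrow> (\<forall>s. 0 \<le> p s) \<and> (p has_sum 1) UNIV"

definition expect :: "grid_fun \<Rightarrow> grid_fun \<Rightarrow> real" where
  "expect p x = (\<Sum>\<^sub>\<infinity>s\<in>UNIV. p s * x s)"

definition weight :: "grid_fun \<Rightarrow> grid_fun \<Rightarrow> grid_fun" where
  "weight eps u s = eps s * (u s)\<^sup>2 / pairing u (B2 eps u)"

definition resid :: "real \<Rightarrow> grid_fun \<Rightarrow> real \<Rightarrow> grid_fun \<Rightarrow> grid_fun" where
  "resid h eps lam u s = A2 h u s - lam * B2 eps u s"

text \<open>A supremum of reals; meaningful only when the set of values is bounded above.\<close>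
definition resid_max :: "real \<Rightarrow> grid_fun \<Rightarrow> real \<Rightarrow> grid_fun \<Rightarrow> real" where
  "resid_max h eps lam u = (SUP s. \<bar>resid h eps lam u s\<bar>)"

end

theory Submission
  imports Defs
begin

text \<open>The weight of a site is \<open>eps s * (u s)\<^sup>2 / D\<close> with
  \<open>D = pairing u (B2 eps u)\<close>, so dividing by \<open>eps s * u s\<close> cancels one
  factor: weight times \<open>x / (eps s * u s)\<close> is \<open>u s * x / D\<close>
  (\<open>weight_div\<close>). With x the value of \<open>A2 h u\<close>, summation gives the
  Rayleigh quotient. With x the residual, bounding it by its supremum leaves the sum of
  \<open>\<bar>u s\<bar>\<close>, hence the constant \<open>C0 / D\<close>. Finally, the residual
  over \<open>eps s * u s\<close> is the pointwise quotient minus \<open>lam\<close>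
  (\<open>resid_div\<close>); as the weights have total mass 1, the bias is the expectation of this
  difference, and the triangle inequality bounds it. The rest is convergence. The lower bound on
  \<open>eps\<close> makes \<open>u\<close> square-summable, so its products with its own translates
  are summable, and \<open>summable_on_mult_A2\<close> follows. For the supremum, an absolutely
  summable \<open>u\<close> is bounded, and \<open>abs_A2_le\<close> with the upper bound on
  \<open>eps\<close> bounds the residual.\<close>

lemma summable_on_shift_iff:
  fixes f :: "'a::group_add \<Rightarrow> 'b::{comm_monoid_add,topological_space}"
  shows "(\<lambda>s. f (s + d)) summable_on UNIV \<longleftrightarrow> f summable_on UNIV"
proof -
  have "bij (\<lambda>s. s + d)"
    by (rule bij_betwI[where g = "\<lambda>s. s - d"]) auto
  then show ?thesis
    by (rule summable_on_reindex_bij_betw)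
qed

text \<open>Since 2|fg| \<le> f^2 + g^2, the sum of the squares is a summable majorant of the
  product.\<close>

lemma summable_on_mult_of_squares:
  fixes f g :: "'a \<Rightarrow> real"
  assumes "(\<lambda>s. (f s)\<^sup>2) summable_on A" and "(\<lambda>s. (g s)\<^sup>2) summable_on A"
  shows "(\<lambda>s. f s * g s) summable_on A"
proof (rule abs_summable_summable, rule summable_on_comparison_test)
  show "(\<lambda>s. (f s)\<^sup>2 + (g s)\<^sup>2) summable_on A"
    using assms by (rule summable_on_add)
  fix s
  have "2 * (\<bar>f s\<bar> * \<bar>g s\<bar>) \<le> (f s)\<^sup>2 + (g s)\<^sup>2"
    using sum_squares_bound[of "\<bar>f s\<bar>" "\<bar>g s\<bar>"] by simp
  moreover have "0 \<le> \<bar>f s\<bar> * \<bar>g s\<bar>"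
    by simp
  ultimately show "norm (f s * g s) \<le> (f s)\<^sup>2 + (g s)\<^sup>2"
    unfolding real_norm_def abs_mult by linarith
qed auto

lemma A2_shift:
  "A2 h u s = (1 / h\<^sup>2) * (4 * u s - u (s + (1, 0)) - u (s + (- 1, 0)) - u (s + (0, 1)) - u (s + (0, - 1)))"
  by (cases s) (simp add: A2_def)

lemma summable_on_mult_A2:
  assumes "(\<lambda>s. (u s)\<^sup>2) summable_on UNIV"
  shows "(\<lambda>s. u s * A2 h u s) summable_on UNIV"
proof -
  have *: "(\<lambda>s. u s * u (s + d)) summable_on UNIV" for d
    using assms summable_on_shift_iff[of "\<lambda>s. (u s)\<^sup>2" d]
    by (intro summable_on_mult_of_squares) auto
  \<comment> \<open>The diagonal term is written with the zero shift \<open>s + 0\<close>, so that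
    \<open>*\<close> covers all five terms of the stencil.\<close>
  have "(\<lambda>s. (1 / h\<^sup>2) * (4 * (u s * u (s + 0)) + - (u s * u (s + (1, 0))) + - (u s * u (s + (- 1, 0)))
      + - (u s * u (s + (0, 1))) + - (u s * u (s + (0, - 1))))) summable_on UNIV"
    by (intro summable_on_cmult_right summable_on_add summable_on_uminus[THEN iffD2] *)
  then show ?thesis
    by (simp add: A2_shift algebra_simps)
qed

text \<open>The factor 8 = 4 + 1 + 1 + 1 + 1 is the sum of the absolute values of the stencil
  coefficients.\<close>

lemma abs_A2_le:
  assumes "\<And>s. \<bar>u s\<bar> \<le> M"
  shows "\<bar>A2 h u s\<bar> \<le> (1 / h\<^sup>2) * (8 * M)"
  unfolding A2_shift abs_mult
  using assms[of s] assms[of "s + (1, 0)"] assms[of "s + (- 1, 0)"]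
    assms[of "s + (0, 1)"] assms[of "s + (0, - 1)"]
  by (intro mult_mono) auto

theorem theorem4p6:
  fixes h eps_min eps_max :: real
    and eps u :: "int \<times> int \<Rightarrow> real"
  assumes "h > 0"
    and "0 < eps_min"
    and "\<And>s. eps_min \<le> eps s \<and> eps s \<le> eps_max"
    and "\<And>s. eps s * u s \<noteq> 0"
    and "(\<lambda>s. eps s * (u s)\<^sup>2) summable_on UNIV"
  shows
    "(pairing u (B2 eps u) = (\<Sum>\<^sub>\<infinity>s\<in>UNIV. eps s * (u s)\<^sup>2) \<and>
      (\<lambda>s. u s * A2 h u s) summable_on UNIV \<and>
      prob_weights (weight eps u) \<and>
      (\<lambda>s. weight eps u s * pointwise_rayleigh h eps u s) summable_on UNIV \<and>
      rayleigh h eps u = pairing u (A2 h u) / pairing u (B2 eps u) \<and>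
      rayleigh h eps u = expect (weight eps u) (pointwise_rayleigh h eps u))
     \<and>
     (\<forall>lam C0. (\<lambda>s. \<bar>u s\<bar>) summable_on UNIV \<and> (\<Sum>\<^sub>\<infinity>s\<in>UNIV. \<bar>u s\<bar>) < C0 \<longrightarrow>
        bdd_above (range (\<lambda>s. \<bar>resid h eps lam u s\<bar>)) \<and>
        (\<lambda>s. weight eps u s * \<bar>resid h eps lam u s / (eps s * u s)\<bar>) summable_on UNIV \<and>
        expect (weight eps u) (\<lambda>s. \<bar>resid h eps lam u s / (eps s * u s)\<bar>)
          \<le> C0 / pairing u (B2 eps u) * resid_max h eps lam u)
     \<and>
     (\<forall>lam C0. (\<lambda>s. \<bar>u s\<bar>) summable_on UNIV \<and> (\<Sum>\<^sub>\<infinity>s\<in>UNIV. \<bar>u s\<bar>) < C0 \<longrightarrow>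
        \<bar>expect (weight eps u) (pointwise_rayleigh h eps u) - lam\<bar>
          \<le> expect (weight eps u) (\<lambda>s. \<bar>resid h eps lam u s / (eps s * u s)\<bar>) \<and>
        expect (weight eps u) (\<lambda>s. \<bar>resid h eps lam u s / (eps s * u s)\<bar>)
          \<le> C0 / pairing u (B2 eps u) * resid_max h eps lam u)"
proof -
  have eps_pos: "0 < eps s" and eps_le: "eps s \<le> eps_max" for s
    using assms(2) assms(3)[of s] by auto
  have u_nz: "u s \<noteq> 0" for s
    using assms(4)[of s] by auto
  define D where "D = pairing u (B2 eps u)"
  have D_eq: "D = (\<Sum>\<^sub>\<infinity>s\<in>UNIV. eps s * (u s)\<^sup>2)"
    unfolding D_def pairing_def B2_def by (simp add: power2_eq_square ac_simps)
  have D_has_sum: "((\<lambda>s. eps s * (u s)\<^sup>2) has_sum D) UNIV"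
    unfolding D_eq using assms(5) by (rule has_sum_infsum)
  have D_pos: "0 < D"
  proof -
    \<comment> \<open>A single site, here the origin, already contributes a positive amount to a sum
      of nonnegative terms.\<close>
    have "(\<Sum>s\<in>{0}. eps s * (u s)\<^sup>2) \<le> D"
      unfolding D_eq using assms(5) eps_pos
      by (intro finite_sum_le_infsum) (auto simp: less_imp_le)
    then show ?thesis
      using eps_pos[of 0] u_nz[of 0] by (smt (verit) mult_pos_pos sum.empty sum.insert
          finite.emptyI empty_iff zero_less_power2)
  qed
  have sq_summable: "(\<lambda>s. (u s)\<^sup>2) summable_on UNIV"
  proof (rule summable_on_comparison_test)
    show "(\<lambda>s. (1 / eps_min) * (eps s * (u s)\<^sup>2)) summable_on UNIV"
      using assms(5) by (rule summable_on_cmult_right)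
    show "(u s)\<^sup>2 \<le> (1 / eps_min) * (eps s * (u s)\<^sup>2)" for s
      using assms(2) assms(3)[of s] by (simp add: field_simps mult_right_mono)
  qed auto
  have uAu: "(\<lambda>s. u s * A2 h u s) summable_on UNIV"
    using sq_summable by (rule summable_on_mult_A2)
  have weight_eq: "weight eps u = (\<lambda>s. (eps s * (u s)\<^sup>2) / D)"
    by (simp add: fun_eq_iff weight_def D_def)
  have weight_has_sum: "(weight eps u has_sum 1) UNIV"
    using has_sum_cmult_left[OF D_has_sum, of "1 / D"] D_pos by (simp add: weight_eq)
  have prob: "prob_weights (weight eps u)"
    using weight_has_sum eps_pos D_pos by (auto simp: prob_weights_def weight_eq less_imp_le)
  have weight_nonneg: "0 \<le> weight eps u s" for s
    using prob unfolding prob_weights_def by blast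
  \<comment> \<open>The central cancellation, stated for arbitrary \<open>x\<close> because it
    serves both \<open>A2 h u s\<close> and the residual.\<close>
  have weight_div: "weight eps u s * (x / (eps s * u s)) = u s * x * (1 / D)" for s x
    using eps_pos[of s] u_nz[of s] D_pos by (simp add: weight_eq power2_eq_square)
  have weighted_pointwise:
    "weight eps u s * pointwise_rayleigh h eps u s = u s * A2 h u s * (1 / D)" for s
    unfolding pointwise_rayleigh_def B2_def by (rule weight_div)
  have pointwise_summable: "(\<lambda>s. weight eps u s * pointwise_rayleigh h eps u s) summable_on UNIV"
    unfolding weighted_pointwise using uAu by (rule summable_on_cmult_left)
  have expect_pointwise: "rayleigh h eps u = expect (weight eps u) (pointwise_rayleigh h eps u)"
    unfolding expect_def weighted_pointwise rayleigh_def D_def[symmetric]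
    by (subst infsum_cmult_left') (simp add: pairing_def)
  have resid_div: "resid h eps lam u s / (eps s * u s) = pointwise_rayleigh h eps u s - lam"
    for lam s
    using assms(4)[of s] by (simp add: resid_def pointwise_rayleigh_def B2_def diff_divide_distrib)
  have residual: "bdd_above (range (\<lambda>s. \<bar>resid h eps lam u s\<bar>)) \<and>
      (\<lambda>s. weight eps u s * \<bar>resid h eps lam u s / (eps s * u s)\<bar>) summable_on UNIV \<and>
      expect (weight eps u) (\<lambda>s. \<bar>resid h eps lam u s / (eps s * u s)\<bar>)
        \<le> C0 / D * resid_max h eps lam u \<and>
      \<bar>expect (weight eps u) (pointwise_rayleigh h eps u) - lam\<bar>
        \<le> expect (weight eps u) (\<lambda>s. \<bar>resid h eps lam u s / (eps s * u s)\<bar>)"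
    if u_abs: "(\<lambda>s. \<bar>u s\<bar>) summable_on UNIV" and C0: "(\<Sum>\<^sub>\<infinity>s\<in>UNIV. \<bar>u s\<bar>) < C0" for lam C0
  proof -
    define M where "M = (\<Sum>\<^sub>\<infinity>s\<in>UNIV. \<bar>u s\<bar>)"
    have u_le: "\<bar>u s\<bar> \<le> M" for s
      unfolding M_def using finite_sum_le_infsum[OF u_abs, of "{s}"] by simp
    have resid_bound: "\<bar>resid h eps lam u s\<bar> \<le> (1 / h\<^sup>2) * (8 * M) + \<bar>lam\<bar> * (eps_max * M)" for s
    proof -
      have "\<bar>lam * (eps s * u s)\<bar> \<le> \<bar>lam\<bar> * (eps_max * M)"
        unfolding abs_mult using eps_pos[of s] eps_le[of s] u_le[of s]
        by (intro mult_left_mono mult_mono) auto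
      with abs_A2_le[of u, OF u_le, of h s] show ?thesis
        unfolding resid_def B2_def by linarith
    qed
    \<comment> \<open>Boundedness is what makes the real supremum in \<open>resid_max\<close> a
      genuine upper bound.\<close>
    then have bdd: "bdd_above (range (\<lambda>s. \<bar>resid h eps lam u s\<bar>))"
      by (auto simp: bdd_above_def)
    define m where "m = resid_max h eps lam u"
    have resid_le: "\<bar>resid h eps lam u s\<bar> \<le> m" for s
      unfolding m_def resid_max_def using bdd by (auto intro: cSUP_upper)
    have m_nonneg: "0 \<le> m"
      using resid_le[of 0] by linarith
    have abs_eq: "weight eps u s * \<bar>resid h eps lam u s / (eps s * u s)\<bar>
        = \<bar>u s\<bar> * \<bar>resid h eps lam u s\<bar> * (1 / D)" for s
    proof -
      have "weight eps u s * \<bar>resid h eps lam u s / (eps s * u s)\<bar>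
          = \<bar>weight eps u s * (resid h eps lam u s / (eps s * u s))\<bar>"
        by (simp add: abs_mult weight_nonneg)
      then show ?thesis
        unfolding weight_div using D_pos by (simp add: abs_mult)
    qed
    \<comment> \<open>This majorant gives both the summability of the weighted residual and the
      estimate of its sum.\<close>
    have abs_le: "weight eps u s * \<bar>resid h eps lam u s / (eps s * u s)\<bar> \<le> \<bar>u s\<bar> * (m * (1 / D))" for s
      unfolding abs_eq mult.assoc using resid_le[of s] D_pos
      by (intro mult_left_mono mult_right_mono) auto
    have bound_summable: "(\<lambda>s. \<bar>u s\<bar> * (m * (1 / D))) summable_on UNIV"
      using u_abs by (rule summable_on_cmult_left)
    have abs_nonneg: "0 \<le> weight eps u s * \<bar>resid h eps lam u s / (eps s * u s)\<bar>" for s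
      by (simp add: weight_nonneg)
    have abs_summable:
      "(\<lambda>s. weight eps u s * \<bar>resid h eps lam u s / (eps s * u s)\<bar>) summable_on UNIV"
      using bound_summable abs_le abs_nonneg by (rule summable_on_comparison_test)
    have "expect (weight eps u) (\<lambda>s. \<bar>resid h eps lam u s / (eps s * u s)\<bar>)
        \<le> (\<Sum>\<^sub>\<infinity>s\<in>UNIV. \<bar>u s\<bar> * (m * (1 / D)))"
      unfolding expect_def using abs_summable bound_summable abs_le by (rule infsum_mono)
    also have "\<dots> = M * (m * (1 / D))"
      unfolding M_def by (rule infsum_cmult_left')
    \<comment> \<open>Passing from \<open>M\<close> to the larger \<open>C0\<close> relies on the
      remaining factor being nonnegative, by \<open>m_nonneg\<close>.\<close>
    also have "\<dots> \<le> C0 * (m * (1 / D))"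
      using C0 m_nonneg D_pos by (intro mult_right_mono) (auto simp: M_def)
    finally have expect_le: "expect (weight eps u) (\<lambda>s. \<bar>resid h eps lam u s / (eps s * u s)\<bar>)
        \<le> C0 / D * m"
      by (simp add: ac_simps)
    \<comment> \<open>The factor 1 in \<open>1 * (- lam)\<close> is the total mass of the weights:
      averaging a constant returns it.\<close>
    have "((\<lambda>s. weight eps u s * pointwise_rayleigh h eps u s + weight eps u s * (- lam)) has_sum
        (expect (weight eps u) (pointwise_rayleigh h eps u) + 1 * (- lam))) UNIV"
      unfolding expect_def
      by (intro has_sum_add has_sum_cmult_left has_sum_infsum pointwise_summable weight_has_sum)
    then have bias: "((\<lambda>s. weight eps u s * (resid h eps lam u s / (eps s * u s))) has_sum
        (expect (weight eps u) (pointwise_rayleigh h eps u) - lam)) UNIV"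
      by (simp add: resid_div algebra_simps)
    have norm_eq: "norm (weight eps u s * (resid h eps lam u s / (eps s * u s)))
        = weight eps u s * \<bar>resid h eps lam u s / (eps s * u s)\<bar>" for s
      by (simp add: abs_mult weight_nonneg)
    \<comment> \<open>The triangle inequality for infinite sums; its left side is the absolute bias
      by \<open>bias\<close>.\<close>
    have "norm (\<Sum>\<^sub>\<infinity>s\<in>UNIV. weight eps u s * (resid h eps lam u s / (eps s * u s)))
        \<le> (\<Sum>\<^sub>\<infinity>s\<in>UNIV. norm (weight eps u s * (resid h eps lam u s / (eps s * u s))))"
      by (rule norm_infsum_bound) (simp only: norm_eq abs_summable)
    then have "\<bar>expect (weight eps u) (pointwise_rayleigh h eps u) - lam\<bar>
        \<le> expect (weight eps u) (\<lambda>s. \<bar>resid h eps lam u s / (eps s * u s)\<bar>)"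
      unfolding norm_eq infsumI[OF bias]
      unfolding expect_def[of _ "\<lambda>s. \<bar>_ s\<bar>"] real_norm_def .
    with bdd abs_summable expect_le show ?thesis
      by (simp add: m_def)
  qed
  show ?thesis
    using D_eq uAu prob pointwise_summable expect_pointwise residual
    unfolding D_def by (auto simp: rayleigh_def)
qed

end
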